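(* Let $m\ge2$ and, for $n_1,\ldots,n_m\in\mathbb{N}_{\ge1}$, let $$\pi_1(n_1,\ldots,n_m)=\mathbb{P}(A_2\le n_2-1,\ldots,A_m\le n_m-1),$$ where $(A_2,\ldots,A_m)$ has a negative multinomial distribution with parameters $(n_1;p_2,\ldots,p_m)$, $p_\ell=\frac{n_\ell}{n_1+\cdots+n_m}$. Then $$\lim_{n_m\to\infty}\cdots\lim_{n_2\to\infty}\lim_{n_1\to\infty}\pi_1(n_1,\ldots,n_m)=\frac{1}{2^{m-1}},$$ and, for every $\ell\in\{2,\ldots,m\}$, $$\lim_{n_2\to\infty}\cdots\lim_{n_{\ell-1}\to\infty}\ \lim_{n_1\to\infty}\ \lim_{n_\ell\to\infty}\cdots\lim_{n_m\to\infty}\pi_1(n_1,\ldots,n_m)=\frac{1}{2^{\ell-1}}.$$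
   Context: Iterated limits are evaluated from the innermost (rightmost) to the outermost (leftmost); for $\ell=2$ the limits over $n_2,\ldots,n_{\ell-1}$ are absent. Negative multinomial distribution with parameters $(n_1;p_2,\ldots,p_m)$, with $p_1:=1-\sum_{k=2}^m p_k>0$: for all integers $k_2,\ldots,k_m\ge0$, $$\mathbb{P}(A_2=k_2,\ldots,A_m=k_m)=\frac{(n_1+k_2+\cdots+k_m-1)!}{(n_1-1)!\,k_2!\cdots k_m!}\,p_1^{n_1}\prod_{\ell=2}^m p_\ell^{k_\ell}.$$ *)

theory Defs
  imports "HOL-Probability.Probability"
begin

definition neg_multinomial_distributed ::
  "'w measure \<Rightarrow> nat set \<Rightarrow> (nat \<Rightarrow> 'w \<Rightarrow> nat) \<Rightarrow> nat \<Rightarrow> (nat \<Rightarrow> real) \<Rightarrow> bool" where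
  "neg_multinomial_distributed M J A r p \<longleftrightarrow>
     prob_space M \<and> finite J \<and> r \<ge> 1 \<and> (\<forall>j\<in>J. 0 \<le> p j) \<and> (1 - (\<Sum>j\<in>J. p j)) > 0 \<and>
     (\<forall>j\<in>J. A j \<in> measurable M (count_space UNIV)) \<and>
     (\<forall>k :: nat \<Rightarrow> nat.
        measure M {\<omega> \<in> space M. \<forall>j\<in>J. A j \<omega> = k j} =
          fact (r + (\<Sum>j\<in>J. k j) - 1) / (fact (r - 1) * (\<Prod>j\<in>J. fact (k j)))
          * (1 - (\<Sum>j\<in>J. p j)) ^ r * (\<Prod>j\<in>J. p j ^ k j))"

(* has_iterated_limit [i1, ..., ik] f n L: the iterated limit
   lim_{n(i1)} ... lim_{n(ik)} f n  (outermost variable first) exists and equals L, where the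
   variables range over the positive integers, each inner limit is required to exist for all
   positive values of the variables further out, and the variables not listed keep the values
   given by n.  The initial values of the listed variables are overwritten. *)
primrec has_iterated_limit ::
  "nat list \<Rightarrow> ((nat \<Rightarrow> nat) \<Rightarrow> real) \<Rightarrow> (nat \<Rightarrow> nat) \<Rightarrow> real \<Rightarrow> bool" where
  "has_iterated_limit [] f n L \<longleftrightarrow> f n = L"
| "has_iterated_limit (i # is) f n L \<longleftrightarrow>
     (\<exists>g :: nat \<Rightarrow> real. (\<forall>N\<ge>1. has_iterated_limit is f (n(i := N)) (g N)) \<and> g \<longlonglongrightarrow> L)"

end

theory Submission
  imports Defs "HOL-Real_Asymp.Real_Asymp"
begin

text \<open>
  A negative multinomial vector is a Poisson mixture: if \<open>X\<close> has the Gamma distribution of shape and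
  rate \<open>n\<^sub>1\<close>, then conditionally on \<open>X\<close> the \<open>A\<^sub>l\<close> are independent Poisson variables with means
  \<open>n\<^sub>l X\<close>. So \<open>\<pi>\<^sub>1\<close> is the expectation of the product over \<open>l\<close> of \<open>Q(n\<^sub>l, n\<^sub>l X)\<close>, where
  \<open>Q(N, t)\<close> is the probability that a Poisson variable of mean \<open>t\<close> is less than \<open>N\<close>.
  As \<open>n\<^sub>1\<close> tends to infinity \<open>X\<close> concentrates at \<open>1\<close>, while \<open>Q(N, N x)\<close> tends to \<open>1\<close> for
  \<open>x < 1\<close> and to \<open>0\<close> for \<open>x > 1\<close>. Both \<open>Q(N, N)\<close> and the probability of \<open>X < 1\<close> tend to \<open>1/2\<close>;
  by the Gamma-Poisson duality this is one and the same fact, a case of the central limit theorem.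
  Hence each of the variables whose limit is taken after that of \<open>n\<^sub>1\<close> contributes a factor \<open>1/2\<close>,
  and those whose limit is taken before contribute a single \<open>1/2\<close> together.
\<close>

section \<open>Poisson tails and concentration of Gamma variables\<close>

definition poisson_below :: "nat \<Rightarrow> real \<Rightarrow> real" where
  "poisson_below N t = (\<Sum>k<N. t ^ k / fact k * exp (- t))"

lemma poisson_below_nonneg: "0 \<le> t \<Longrightarrow> 0 \<le> poisson_below N t"
  unfolding poisson_below_def by (intro sum_nonneg) auto

text \<open>Gamma-Poisson duality: in a Poisson process of rate \<open>l\<close>, fewer than
  \<open>N\<close> arrivals up to time \<open>x\<close> means that the \<open>N\<close>-th arrival
  comes after \<open>x\<close>. The library indexes Erlang laws by shape minus one, hence
  \<open>N - 1\<close>.\<close>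

lemma poisson_below_eq_erlang_CDF:
  assumes "N \<ge> 1" "0 < l" "0 \<le> x"
  shows "poisson_below N (l * x) = 1 - erlang_CDF (N - 1) l x"
proof -
  have "{..<N} = {..N - 1}" using assms by auto
  then show ?thesis using assms by (simp add: poisson_below_def erlang_CDF_def)
qed

lemma poisson_below_le_1:
  assumes "0 \<le> t" shows "poisson_below N t \<le> 1"
proof (cases "N = 0")
  case False
  then show ?thesis
    using poisson_below_eq_erlang_CDF[of N 1 t] erlang_CDF_nonneg[of 1 "N - 1" t] assms by simp
qed (simp add: poisson_below_def)

lemma isCont_poisson_below: "isCont (poisson_below N) x"
  unfolding poisson_below_def by (intro continuous_intros) auto

lemma poisson_below_measurable [measurable]: "poisson_below N \<in> borel_measurable borel"
  unfolding poisson_below_def by measurable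

text \<open>The Gamma distribution of shape \<open>N\<close> and rate \<open>N\<close>, hence of mean \<open>1\<close> and variance \<open>1/N\<close>:
  \<^const>\<open>erlang_density\<close> takes the shape minus one. Only meaningful for \<open>N \<ge> 1\<close>.\<close>

definition mean1_gamma :: "nat \<Rightarrow> real measure" where
  "mean1_gamma N = density lborel (erlang_density (N - 1) (real N))"

lemma sets_mean1_gamma [measurable_cong, simp]: "sets (mean1_gamma N) = sets borel"
  by (simp add: mean1_gamma_def)

lemma space_mean1_gamma [simp]: "space (mean1_gamma N) = UNIV"
  by (simp add: mean1_gamma_def)

lemma prob_space_mean1_gamma: "N \<ge> 1 \<Longrightarrow> prob_space (mean1_gamma N)"
  unfolding mean1_gamma_def by (rule prob_space_erlang_density) simp

lemma mean1_gamma_total_tendsto: "(\<lambda>N. \<integral>x. 1 \<partial>mean1_gamma N) \<longlonglongrightarrow> (1::real)"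
  by (rule tendsto_eventually, rule eventually_sequentiallyI[of 1])
     (use prob_space.prob_space[OF prob_space_mean1_gamma] in auto)

lemma AE_mean1_gamma_nonneg: "AE x in mean1_gamma N. 0 \<le> x"
  unfolding mean1_gamma_def by (subst AE_density) (auto simp: erlang_density_def)

lemma AE_mean1_gamma_neq: "AE x in mean1_gamma N. x \<noteq> a"
  unfolding mean1_gamma_def using AE_lborel_singleton[of a] by (subst AE_density) auto

lemma measure_mean1_gamma_greaterThan:
  assumes "N \<ge> 1" "0 \<le> x"
  shows "measure (mean1_gamma N) {x<..} = poisson_below N (real N * x)"
proof -
  interpret prob_space "mean1_gamma N" using assms(1) by (rule prob_space_mean1_gamma)
  have "emeasure (mean1_gamma N) {..x} = ennreal (erlang_CDF (N - 1) (real N) x)"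
    unfolding mean1_gamma_def using assms by (intro emeasure_erlang_density) simp
  then have "prob {..x} = erlang_CDF (N - 1) (real N) x"
    using assms by (simp add: measure_def)
  moreover have "prob {x<..} = 1 - prob {..x}"
    using prob_compl[of "{..x}"] by (simp add: Compl_eq_Diff_UNIV[symmetric] Compl_atMost)
  ultimately show ?thesis
    using assms poisson_below_eq_erlang_CDF[of N "real N" x] by simp
qed

lemma measure_mean1_gamma_lessThan:
  assumes "N \<ge> 1" "0 \<le> x"
  shows "measure (mean1_gamma N) {..<x} = 1 - poisson_below N (real N * x)"
proof -
  interpret prob_space "mean1_gamma N" using assms(1) by (rule prob_space_mean1_gamma)
  have "prob {..<x} = prob {..x}"
    using AE_mean1_gamma_neq[of x N] by (intro finite_measure_eq_AE) (auto elim!: eventually_mono)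
  also have "\<dots> = 1 - prob {x<..}"
    using prob_compl[of "{..x}"] by (simp add: Compl_eq_Diff_UNIV[symmetric] Compl_atMost)
  finally show ?thesis using measure_mean1_gamma_greaterThan[OF assms] by simp
qed

lemma has_bochner_integral_mean1_gamma_square_deviation:
  assumes "N \<ge> 1"
  shows "has_bochner_integral (mean1_gamma N) (\<lambda>x. (x - 1)\<^sup>2) (1 / real N)"
proof -
  interpret prob_space "mean1_gamma N" using assms by (rule prob_space_mean1_gamma)
  have D: "distributed (mean1_gamma N) lborel (\<lambda>x. x) (erlang_density (N - 1) (real N))"
    using assms unfolding distributed_def
    by (auto simp: mean1_gamma_def intro!: distr_id2)
  have pos: "0 < real N" using assms by simp
  obtain r where r: "N = Suc r" using assms by (cases N) auto
  note mom = has_bochner_integral_erlang_ith_moment[OF pos D]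
  \<comment> \<open>The powers \<open>x ^ 1\<close> and \<open>x ^ 0\<close> stay explicit so that
    each term matches the moment formula for \<open>x ^ i\<close>.\<close>
  have "has_bochner_integral (mean1_gamma N) (\<lambda>x. x ^ 2 - 2 * x ^ 1 + x ^ 0)
    (fact (N - 1 + 2) / (fact (N - 1) * real N ^ 2) - 2 * (fact (N - 1 + 1) / (fact (N - 1) * real N ^ 1))
      + fact (N - 1 + 0) / (fact (N - 1) * real N ^ 0))"
    by (intro has_bochner_integral_add has_bochner_integral_diff has_bochner_integral_mult_right mom)
  moreover have "(fact (N - 1 + 2) / (fact (N - 1) * real N ^ 2) - 2 * (fact (N - 1 + 1) / (fact (N - 1) * real N ^ 1))
      + fact (N - 1 + 0) / (fact (N - 1) * real N ^ 0)) = 1 / real N"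
  proof -
    have "fact (N - 1 + 2) = fact r * ((real r + 1) * (real r + 2))" "fact (N - 1 + 1) = fact r * (real r + 1)"
      by (simp_all add: r algebra_simps)
    moreover have "real N = real r + 1" "N - 1 = r" by (simp_all add: r)
    moreover have "fact r \<noteq> (0::real)" "real r + 1 \<noteq> 0" by simp_all
    ultimately show ?thesis by (simp add: power2_eq_square divide_simps) (simp add: algebra_simps)
  qed
  moreover have "(\<lambda>x::real. x ^ 2 - 2 * x ^ 1 + x ^ 0) = (\<lambda>x. (x - 1)\<^sup>2)"
    by (auto simp: power2_eq_square algebra_simps)
  ultimately show ?thesis by metis
qed

text \<open>Chebyshev: \<open>\<bar>h x - h 1\<bar> \<le> e / 2 + 2 (x - 1)\<^sup>2 / d\<^sup>2\<close>, and the last term has expectation \<open>2 / (N d\<^sup>2)\<close>.\<close>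

lemma expectation_mean1_gamma_deviation_tendsto_0:
  fixes h :: "real \<Rightarrow> real"
  assumes [measurable]: "h \<in> borel_measurable borel"
    and cont: "isCont h 1" and bound: "\<And>x. 0 \<le> x \<Longrightarrow> \<bar>h x\<bar> \<le> 1"
  shows "(\<lambda>N. \<integral>x. \<bar>h x - h 1\<bar> \<partial>mean1_gamma N) \<longlonglongrightarrow> 0"
proof (rule LIMSEQ_I)
  fix e :: real assume e: "0 < e"
  obtain d where d: "d > 0" and hd: "\<And>x. \<bar>x - 1\<bar> < d \<Longrightarrow> \<bar>h x - h 1\<bar> < e / 2"
    using cont e unfolding isCont_def LIM_eq
    by (metis (no_types) abs_zero diff_self half_gt_zero real_norm_def)
  \<comment> \<open>This threshold makes the Chebyshev term \<open>2 / (N * d\<^sup>2)\<close>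
    smaller than \<open>e / 2\<close>.\<close>
  obtain N0 :: nat where N0: "4 / (d\<^sup>2 * e) < real N0" using reals_Archimedean2 by blast
  show "\<exists>no. \<forall>N\<ge>no. norm ((\<integral>x. \<bar>h x - h 1\<bar> \<partial>mean1_gamma N) - 0) < e"
  proof (intro exI allI impI)
    fix N assume N: "N \<ge> max 1 N0"
    then have N1: "N \<ge> 1" by simp
    interpret prob_space "mean1_gamma N" using N1 by (rule prob_space_mean1_gamma)
    note V = has_bochner_integral_mean1_gamma_square_deviation[OF N1]
    have dom: "\<bar>h x - h 1\<bar> \<le> e / 2 + 2 / d\<^sup>2 * (x - 1)\<^sup>2" if "0 \<le> x" for x
    proof (cases "\<bar>x - 1\<bar> < d")
      case True
      have "0 \<le> 2 / d\<^sup>2 * (x - 1)\<^sup>2" by simp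
      with hd[OF True] show ?thesis by linarith
    next
      case False
      then have "d\<^sup>2 \<le> (x - 1)\<^sup>2"
        using d by (metis abs_le_square_iff abs_of_pos linorder_not_less)
      then have "2 \<le> 2 / d\<^sup>2 * (x - 1)\<^sup>2" using d by (simp add: field_simps)
      moreover have "\<bar>h x - h 1\<bar> \<le> 2" using bound[OF that] bound[of 1] by simp
      ultimately show ?thesis using e by linarith
    qed
    have "(\<integral>x. \<bar>h x - h 1\<bar> \<partial>mean1_gamma N) \<le> (\<integral>x. e / 2 + 2 / d\<^sup>2 * (x - 1)\<^sup>2 \<partial>mean1_gamma N)"
    proof (rule integral_mono_AE)
      show "integrable (mean1_gamma N) (\<lambda>x. \<bar>h x - h 1\<bar>)"
      proof (rule integrable_const_bound[where B = 2])
        show "AE x in mean1_gamma N. norm \<bar>h x - h 1\<bar> \<le> 2"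
          using AE_mean1_gamma_nonneg
          by eventually_elim (use bound bound[of 1] in fastforce)
      qed measurable
      show "integrable (mean1_gamma N) (\<lambda>x. e / 2 + 2 / d\<^sup>2 * (x - 1)\<^sup>2)"
        using V by (auto simp: has_bochner_integral_iff)
      show "AE x in mean1_gamma N. \<bar>h x - h 1\<bar> \<le> e / 2 + 2 / d\<^sup>2 * (x - 1)\<^sup>2"
        using AE_mean1_gamma_nonneg by eventually_elim (rule dom)
    qed
    also have "\<dots> = e / 2 + 2 / d\<^sup>2 * (1 / real N)"
      using V prob_space by (simp add: has_bochner_integral_iff mult.commute)
    also have "\<dots> < e"
    proof -
      have "4 / (d\<^sup>2 * e) < real N" using N0 N by (meson le_trans max.cobounded2 of_nat_mono order_less_le_trans)
      then show ?thesis using d e N1 by (simp add: field_simps)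
    qed
    finally show "norm ((\<integral>x. \<bar>h x - h 1\<bar> \<partial>mean1_gamma N) - 0) < e"
      by (simp add: integral_nonneg)
  qed
qed

text \<open>Concentration at 1 allows \<open>h\<close> to be replaced by the constant
  \<open>h 1\<close>: since \<open>w\<close> is bounded by 1, the error is at most the expectation
  of \<open>\<bar>h x - h 1\<bar>\<close>. The weight may jump at 1, as
  \<open>indicator {..<1}\<close> does.\<close>

lemma expectation_mean1_gamma_mult_tendsto:
  fixes h w :: "real \<Rightarrow> real"
  assumes [measurable]: "h \<in> borel_measurable borel" "w \<in> borel_measurable borel"
    and cont: "isCont h 1" and bound: "\<And>x. 0 \<le> x \<Longrightarrow> \<bar>h x\<bar> \<le> 1"
    and w: "\<And>x. \<bar>w x\<bar> \<le> 1"
    and lim: "(\<lambda>N. \<integral>x. w x \<partial>mean1_gamma N) \<longlonglongrightarrow> L"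
  shows "(\<lambda>N. \<integral>x. h x * w x \<partial>mean1_gamma N) \<longlonglongrightarrow> h 1 * L"
proof -
  have "(\<lambda>N. (\<integral>x. h x * w x \<partial>mean1_gamma N) - h 1 * (\<integral>x. w x \<partial>mean1_gamma N)) \<longlonglongrightarrow> 0"
  proof (rule Lim_null_comparison[OF _ expectation_mean1_gamma_deviation_tendsto_0[OF assms(1) cont bound]])
    show "\<forall>\<^sub>F N in sequentially. norm ((\<integral>x. h x * w x \<partial>mean1_gamma N) - h 1 * (\<integral>x. w x \<partial>mean1_gamma N))
        \<le> (\<integral>x. \<bar>h x - h 1\<bar> \<partial>mean1_gamma N)"
    proof (rule eventually_sequentiallyI)
      fix N :: nat assume N: "1 \<le> N"
      interpret prob_space "mean1_gamma N" using N by (rule prob_space_mean1_gamma)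
      have ih: "integrable (mean1_gamma N) h"
        using AE_mean1_gamma_nonneg[of N]
        by (intro integrable_const_bound[where B = 1]) (auto elim!: eventually_mono simp: bound)
      have iw: "integrable (mean1_gamma N) w"
        by (intro integrable_const_bound[where B = 1]) (auto simp: w)
      have ihw: "integrable (mean1_gamma N) (\<lambda>x. h x * w x)"
        using AE_mean1_gamma_nonneg[of N]
        by (intro integrable_const_bound[where B = 1])
          (auto elim!: eventually_mono simp: bound w abs_mult intro!: mult_le_one)
      have "(\<integral>x. h x * w x \<partial>mean1_gamma N) - h 1 * (\<integral>x. w x \<partial>mean1_gamma N)
          = (\<integral>x. h x * w x - h 1 * w x \<partial>mean1_gamma N)"
        using ihw iw by simp
      also have "norm \<dots> \<le> (\<integral>x. norm (h x * w x - h 1 * w x) \<partial>mean1_gamma N)"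
        by (rule integral_norm_bound)
      also have "\<dots> \<le> (\<integral>x. \<bar>h x - h 1\<bar> \<partial>mean1_gamma N)"
      proof (rule integral_mono)
        show "integrable (mean1_gamma N) (\<lambda>x. norm (h x * w x - h 1 * w x))"
          using ihw iw by auto
        show "integrable (mean1_gamma N) (\<lambda>x. \<bar>h x - h 1\<bar>)" using ih by auto
        fix x
        have "norm (h x * w x - h 1 * w x) = \<bar>h x - h 1\<bar> * \<bar>w x\<bar>"
          by (simp add: left_diff_distrib[symmetric] abs_mult)
        also have "\<dots> \<le> \<bar>h x - h 1\<bar> * 1" by (intro mult_left_mono w) simp
        finally show "norm (h x * w x - h 1 * w x) \<le> \<bar>h x - h 1\<bar>" by simp
      qed
      finally show "norm ((\<integral>x. h x * w x \<partial>mean1_gamma N) - h 1 * (\<integral>x. w x \<partial>mean1_gamma N))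
        \<le> (\<integral>x. \<bar>h x - h 1\<bar> \<partial>mean1_gamma N)" .
    qed
  qed
  from tendsto_add[OF this tendsto_mult_left[OF lim, of "h 1"]] show ?thesis by simp
qed

text \<open>By duality the sequence is the mass of \<open>{x<..}\<close> under
  \<open>mean1_gamma N\<close>, which concentrates at 1. The indicator of that half-line is locally
  constant at 1 because \<open>x\<close> differs from 1.\<close>

lemma poisson_below_scaled_tendsto:
  assumes x: "0 \<le> x" "x \<noteq> 1"
  shows "(\<lambda>N. poisson_below N (real N * x)) \<longlonglongrightarrow> indicator {..<1} x"
proof -
  let ?h = "\<lambda>y. if y \<le> x then 0 else 1 :: real"
  have h1: "?h 1 = indicator {..<1} x" using x by (auto simp: indicator_def)
  have "(\<lambda>N. \<integral>y. ?h y * 1 \<partial>mean1_gamma N) \<longlonglongrightarrow> ?h 1 * 1"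
  proof (rule expectation_mean1_gamma_mult_tendsto)
    have "\<forall>\<^sub>F y in at (1::real). ?h y = ?h 1"
    proof (cases "x < 1")
      case True
      then have "\<forall>\<^sub>F y in at (1::real). x < y" by (rule order_tendstoD[OF tendsto_ident_at])
      then show ?thesis by eventually_elim (use True in auto)
    next
      case False
      then have "1 < x" using x by simp
      then have "\<forall>\<^sub>F y in at (1::real). y < x" by (rule order_tendstoD[OF tendsto_ident_at])
      then show ?thesis by eventually_elim (use \<open>1 < x\<close> in auto)
    qed
    then show "isCont ?h 1" unfolding isCont_def by (rule tendsto_eventually)
  qed (use mean1_gamma_total_tendsto in auto)
  moreover have "\<forall>\<^sub>F N in sequentially. (\<integral>y. ?h y * 1 \<partial>mean1_gamma N) = poisson_below N (real N * x)"
  proof (rule eventually_sequentiallyI)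
    fix N :: nat assume "1 \<le> N"
    have "(\<integral>y. ?h y * 1 \<partial>mean1_gamma N) = (\<integral>y. indicator {x<..} y \<partial>mean1_gamma N)"
      by (intro Bochner_Integration.integral_cong) (auto simp: indicator_def)
    also have "\<dots> = poisson_below N (real N * x)"
      using measure_mean1_gamma_greaterThan[OF \<open>1 \<le> N\<close> x(1)] by simp
    finally show "(\<integral>y. ?h y * 1 \<partial>mean1_gamma N) = poisson_below N (real N * x)" .
  qed
  ultimately show ?thesis unfolding h1 by (simp add: Lim_transform_eventually)
qed

section \<open>The central limit theorem for Poisson variables\<close>

lemma char_poisson_normalized:
  assumes l: "0 < l"
  shows "char (distr (measure_pmf (poisson_pmf l)) borel (\<lambda>k. (real k - l) / sqrt l)) t =
    exp (of_real l * (iexp (t / sqrt l) - 1) - \<i> * of_real (t * sqrt l))"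
proof -
  let ?z = "iexp (t / sqrt l)"
  \<comment> \<open>\<open>?c\<close> collects the factors independent of \<open>k\<close>; what
    remains is the exponential series at \<open>l * ?z\<close>.\<close>
  let ?c = "exp (- \<i> * of_real (t * sqrt l)) * exp (- of_real l) :: complex"
  have sq: "l / sqrt l = sqrt l" using l by (simp add: real_div_sqrt)
  have e: "pmf (poisson_pmf l) k *\<^sub>R iexp (t * ((real k - l) / sqrt l)) = ?c * ((of_real l * ?z) ^ k /\<^sub>R fact k)" for k
  proof -
    have "t * ((real k - l) / sqrt l) = real k * (t / sqrt l) - t * sqrt l"
      using sq by (simp add: diff_divide_distrib right_diff_distrib)
    then have "iexp (t * ((real k - l) / sqrt l)) = iexp (real k * (t / sqrt l) - t * sqrt l)" by simp
    also have "\<dots> = ?z ^ k * exp (- \<i> * of_real (t * sqrt l))"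
      by (simp add: exp_of_nat_mult[symmetric] exp_add[symmetric] algebra_simps exp_diff exp_minus field_simps del: of_real_mult)
         (simp add: algebra_simps)
    finally show ?thesis using l
      by (simp add: power_mult_distrib scaleR_conv_of_real exp_of_real[symmetric] field_simps)
  qed
  have s: "(\<lambda>k. ?c * ((of_real l * ?z) ^ k /\<^sub>R fact k)) sums (?c * exp (of_real l * ?z))"
    by (intro sums_mult exp_converges)
  have "char (distr (measure_pmf (poisson_pmf l)) borel (\<lambda>k. (real k - l) / sqrt l)) t =
      (\<integral>k. iexp (t * ((real k - l) / sqrt l)) \<partial>measure_pmf (poisson_pmf l))"
    unfolding char_def by (subst integral_distr) auto
  also have "\<dots> = (\<integral>k. pmf (poisson_pmf l) k *\<^sub>R iexp (t * ((real k - l) / sqrt l)) \<partial>count_space UNIV)"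
    unfolding measure_pmf_eq_density by (rule integral_density) (rule borel_measurable_count_space measurable_count_space AE_I2 pmf_nonneg)+
  also have "\<dots> = ?c * exp (of_real l * ?z)"
  proof -
    \<comment> \<open>Absolute convergence identifies the integral over the counting measure with
      the sum of the series.\<close>
    have "summable (\<lambda>k. norm (?c * ((of_real l * ?z) ^ k /\<^sub>R fact k)))"
      unfolding norm_mult[of ?c] by (intro summable_mult summable_norm_exp)
    then have "integrable (count_space UNIV) (\<lambda>k. ?c * ((of_real l * ?z) ^ k /\<^sub>R fact k))"
      by (simp add: integrable_count_space_nat_iff)
    from sums_unique2[OF sums_integral_count_space_nat[OF this] s] show ?thesis
      unfolding e .
  qed
  also have "\<dots> = exp (of_real l * (?z - 1) - \<i> * of_real (t * sqrt l))"
    by (simp add: exp_add[symmetric] algebra_simps del: of_real_mult)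
  finally show ?thesis .
qed

lemma real_distribution_distr_pmf: "real_distribution (distr (measure_pmf p) borel f)"
  by (rule prob_space.real_distribution_distr[OF measure_pmf.prob_space_axioms]) simp

text \<open>Levy's continuity theorem reduces the claim to convergence of the exponents of the
  characteristic functions. The index \<open>Suc N\<close> keeps the Poisson mean positive, as
  \<open>char_poisson_normalized\<close> requires.\<close>

lemma poisson_normalized_weak_conv:
  "weak_conv_m (\<lambda>N. distr (measure_pmf (poisson_pmf (real (Suc N)))) borel
     (\<lambda>k. (real k - real (Suc N)) / sqrt (real (Suc N)))) std_normal_distribution"
proof (rule levy_continuity)
  fix t
  \<comment> \<open>With \<open>u = t / sqrt (real (Suc N))\<close>, the real part rests on
    \<open>cos u - 1\<close> being asymptotic to \<open>- u\<^sup>2 / 2\<close>, the imaginary part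
    on \<open>sin u - u\<close> being of order \<open>u ^ 3\<close>.\<close>
  have re: "(\<lambda>N. real (Suc N) * (cos (t / sqrt (real (Suc N))) - 1)) \<longlonglongrightarrow> - t\<^sup>2 / 2"
    by (cases "t = 0") (simp, real_asymp simp: power2_eq_square)
  have im: "(\<lambda>N. real (Suc N) * sin (t / sqrt (real (Suc N))) - t * sqrt (real (Suc N))) \<longlonglongrightarrow> 0"
    by (cases "t = 0") (simp, real_asymp)
  have "(\<lambda>N. of_real (real (Suc N)) * (iexp (t / sqrt (real (Suc N))) - 1) - \<i> * of_real (t * sqrt (real (Suc N))))
      = (\<lambda>N. Complex (real (Suc N) * (cos (t / sqrt (real (Suc N))) - 1)) (real (Suc N) * sin (t / sqrt (real (Suc N))) - t * sqrt (real (Suc N))))"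
    by (rule ext, rule complex_eqI) (simp_all add: Re_exp Im_exp)
  also have "\<dots> \<longlonglongrightarrow> Complex (- t\<^sup>2 / 2) 0"
    by (intro tendsto_Complex re im)
  finally have "(\<lambda>N. exp (of_real (real (Suc N)) * (iexp (t / sqrt (real (Suc N))) - 1) - \<i> * of_real (t * sqrt (real (Suc N)))))
      \<longlonglongrightarrow> exp (Complex (- t\<^sup>2 / 2) 0)"
    by (rule tendsto_exp)
  moreover have "exp (Complex (- t\<^sup>2 / 2) 0) = char std_normal_distribution t"
    unfolding complex_of_real_def[symmetric] exp_of_real char_std_normal_distribution ..
  ultimately show "(\<lambda>N. char (distr (measure_pmf (poisson_pmf (real (Suc N)))) borel
     (\<lambda>k. (real k - real (Suc N)) / sqrt (real (Suc N)))) t) \<longlonglongrightarrow> char std_normal_distribution t"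
    by (simp only: char_poisson_normalized of_nat_0_less_iff zero_less_Suc)
qed (rule real_distribution_distr_pmf real_dist_normal_dist)+

text \<open>The density is invariant under reflection at 0, and the point 0 has no mass.\<close>

lemma measure_std_normal_lessThan_0: "measure std_normal_distribution {..<0} = 1 / 2"
proof -
  interpret real_distribution std_normal_distribution by (rule real_dist_normal_dist)
  have "emeasure std_normal_distribution {..<0} = (\<integral>\<^sup>+x. ennreal (std_normal_density x) * indicator {..<0} x \<partial>lborel)"
    by (simp add: emeasure_density)
  also have "\<dots> = (\<integral>\<^sup>+x. ennreal (std_normal_density x) * indicator {0<..} x \<partial>lborel)"
    by (subst nn_integral_real_affine[where c = "-1" and t = 0])
       (auto simp: std_normal_density_def indicator_def intro!: nn_integral_cong)
  also have "\<dots> = emeasure std_normal_distribution {0<..}"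
    by (simp add: emeasure_density)
  finally have "prob {..<0} = prob {0<..}" by (simp add: measure_def)
  moreover have "prob {0<..} = 1 - prob {..0}"
    using prob_compl[of "{..0}"] by (simp add: Compl_eq_Diff_UNIV[symmetric] Compl_atMost)
  moreover have "prob {..<0} = prob {..0}"
  proof (rule finite_measure_eq_AE)
    have "AE x in std_normal_distribution. x \<noteq> 0"
      using AE_lborel_singleton[of "0::real"] by (subst AE_density) auto
    then show "AE x in std_normal_distribution. (x \<in> {..<0}) = (x \<in> {..0})"
      by eventually_elim auto
  qed auto
  ultimately show ?thesis by simp
qed

text \<open>A Poisson variable lies below its mean exactly when its normalization is negative, and
  \<open>{..<0}\<close> is a continuity set of the normal law.\<close>

lemma poisson_below_mean_tendsto: "(\<lambda>N. poisson_below N (real N)) \<longlonglongrightarrow> 1 / 2"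
proof -
  let ?D = "\<lambda>N. distr (measure_pmf (poisson_pmf (real (Suc N)))) borel
     (\<lambda>k. (real k - real (Suc N)) / sqrt (real (Suc N)))"
  have "(\<lambda>N. measure (?D N) {..<0}) \<longlonglongrightarrow> measure std_normal_distribution {..<0}"
  proof (rule weak_conv_imp_continuity_set_conv[OF _ real_dist_normal_dist poisson_normalized_weak_conv])
    have "emeasure std_normal_distribution {0} = 0"
      by (simp add: emeasure_density nn_integral_indicator_singleton)
    moreover have "frontier {..<0} = {0::real}" by (auto simp: frontier_def interior_open)
    ultimately show "emeasure std_normal_distribution (frontier {..<0}) = 0"
      by simp
  qed (auto simp: real_distribution_distr_pmf)
  moreover have "measure (?D N) {..<0} = poisson_below (Suc N) (real (Suc N))" for N
  proof -
    have "measure (?D N) {..<0} = measure (measure_pmf (poisson_pmf (real (Suc N)))) {..<Suc N}"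
      by (subst measure_distr) (auto intro!: arg_cong2[where f = measure] simp: field_simps)
    also have "\<dots> = poisson_below (Suc N) (real (Suc N))"
      by (simp add: measure_measure_pmf_finite poisson_below_def)
    finally show ?thesis .
  qed
  ultimately have "(\<lambda>N. poisson_below (Suc N) (real (Suc N))) \<longlonglongrightarrow> 1 / 2"
    by (simp only: measure_std_normal_lessThan_0)
  then show ?thesis by (rule LIMSEQ_imp_Suc)
qed

section \<open>The negative multinomial distribution as a Poisson mixture\<close>

lemma has_bochner_integral_erlang_density:
  "0 < l \<Longrightarrow> has_bochner_integral lborel (erlang_density k l) 1"
  using nn_integral_erlang_ith_moment[of l k 0]
  by (intro has_bochner_integral_nn_integral) auto

text \<open>Conjugacy: the Gamma density times the Poisson weights is a constant multiple of the
  Erlang density of shape \<open>r + (\<Sum>j\<in>J. k j)\<close> and rate \<open>S\<close>, which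
  integrates to 1. The constant is the negative multinomial weight.\<close>

lemma has_bochner_integral_poisson_mixture:
  assumes J: "finite J" and r: "r \<ge> 1" and c: "\<And>j. j \<in> J \<Longrightarrow> 0 \<le> c j"
  defines "S \<equiv> real r + (\<Sum>j\<in>J. c j)"
  shows "has_bochner_integral (mean1_gamma r) (\<lambda>x. \<Prod>j\<in>J. (c j * x) ^ k j / fact (k j) * exp (- (c j * x)))
     (fact (r + (\<Sum>j\<in>J. k j) - 1) / (fact (r - 1) * (\<Prod>j\<in>J. fact (k j)))
          * (real r / S) ^ r * (\<Prod>j\<in>J. (c j / S) ^ k j))" (is "has_bochner_integral _ ?f ?C")
proof -
  let ?K = "\<Sum>j\<in>J. k j"
  have S: "S > 0" unfolding S_def using r sum_nonneg[of J c, OF c] by linarith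
  obtain q where q: "r = Suc q" using r by (cases r) auto
  have [measurable]: "?f \<in> borel_measurable borel" by measurable
  have eq: "erlang_density (r - 1) (real r) x *\<^sub>R ?f x = ?C * erlang_density (q + ?K) S x" for x
  proof (cases "x < 0")
    case False
    have "?f x = (\<Prod>j\<in>J. c j ^ k j) / (\<Prod>j\<in>J. fact (k j)) * x ^ ?K * exp (- (\<Sum>j\<in>J. c j) * x)"
      using J by (simp add: prod.distrib prod_dividef power_mult_distrib power_sum exp_sum[symmetric] sum_negf sum_distrib_right)
    moreover have "(\<Prod>j\<in>J. (c j / S) ^ k j) = (\<Prod>j\<in>J. c j ^ k j) / S ^ ?K"
      by (simp add: power_divide prod_dividef power_sum)
    moreover have "exp (- (\<Sum>j\<in>J. c j) * x) * exp (- real r * x) = exp (- S * x)"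
      by (simp add: exp_add[symmetric] S_def algebra_simps)
    moreover have "erlang_density (r - 1) (real r) x = real r ^ r * x ^ q * exp (- real r * x) / fact q"
      using False by (simp add: erlang_density_def q)
    moreover have "erlang_density (q + ?K) S x = S ^ r * S ^ ?K * x ^ q * x ^ ?K * exp (- S * x) / fact (q + ?K)"
      using False by (simp add: erlang_density_def q power_add)
    moreover have "r + ?K - 1 = q + ?K" "r - 1 = q" by (simp_all add: q)
    moreover have "(\<Prod>j\<in>J. fact (k j)) \<noteq> (0::real)" using J by simp
    ultimately show ?thesis
      using S by (simp only: power_divide) (simp add: field_simps)
  qed (simp add: erlang_density_def)
  have "has_bochner_integral lborel (\<lambda>x. ?C * erlang_density (q + ?K) S x) (?C * 1)"
    by (intro has_bochner_integral_mult_right has_bochner_integral_erlang_density S)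
  then have "has_bochner_integral lborel (\<lambda>x. erlang_density (r - 1) (real r) x *\<^sub>R ?f x) ?C"
    unfolding eq by simp
  then show ?thesis
    unfolding mean1_gamma_def by (intro has_bochner_integral_density) auto
qed

text \<open>The event is split into the finitely many values of the vector in a box; each has a
  mixture integral as its probability, and under the integral the sum over the box factors.\<close>

lemma neg_multinomial_measure_below:
  fixes A :: "nat \<Rightarrow> 'w \<Rightarrow> nat"
  assumes nm: "neg_multinomial_distributed M J A r (\<lambda>j. c j / (real r + (\<Sum>j\<in>J. c j)))"
    and c: "\<And>j. j \<in> J \<Longrightarrow> 0 \<le> c j"
  shows "measure M {\<omega> \<in> space M. \<forall>j\<in>J. A j \<omega> < N j} =
    (\<integral>x. (\<Prod>j\<in>J. poisson_below (N j) (c j * x)) \<partial>mean1_gamma r)"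
proof -
  define S where "S = real r + (\<Sum>j\<in>J. c j)"
  interpret prob_space M using nm by (simp add: neg_multinomial_distributed_def)
  have J: "finite J" and r: "r \<ge> 1"
    and A [measurable]: "\<And>j. j \<in> J \<Longrightarrow> A j \<in> measurable M (count_space UNIV)"
    using nm by (auto simp: neg_multinomial_distributed_def)
  have S: "S > 0" unfolding S_def using r sum_nonneg[of J c, OF c] by linarith
  have p1: "1 - (\<Sum>j\<in>J. c j / S) = real r / S"
    using S by (simp add: sum_divide_distrib[symmetric] field_simps) (simp add: S_def)
  have pmf: "prob {\<omega> \<in> space M. \<forall>j\<in>J. A j \<omega> = k j} =
     (\<integral>x. (\<Prod>j\<in>J. (c j * x) ^ k j / fact (k j) * exp (- (c j * x))) \<partial>mean1_gamma r)" for k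
    using nm has_bochner_integral_integral_eq[OF has_bochner_integral_poisson_mixture[where J = J and c = c and k = k, OF J r c]]
    unfolding neg_multinomial_distributed_def S_def[symmetric] p1 by simp
  let ?P = "PiE J (\<lambda>j. {..<N j})"
  let ?E = "\<lambda>k. {\<omega> \<in> space M. \<forall>j\<in>J. A j \<omega> = k j}"
  have fin: "finite ?P" using J by (intro finite_PiE) auto
  have "{\<omega> \<in> space M. \<forall>j\<in>J. A j \<omega> < N j} = (\<Union>k\<in>?P. ?E k)"
  proof (intro equalityI subsetI)
    fix \<omega> assume "\<omega> \<in> {\<omega> \<in> space M. \<forall>j\<in>J. A j \<omega> < N j}"
    then show "\<omega> \<in> (\<Union>k\<in>?P. ?E k)"
      by (intro UN_I[of "restrict (\<lambda>j. A j \<omega>) J"]) auto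
  qed (fastforce simp: PiE_iff)
  moreover have "prob (\<Union>k\<in>?P. ?E k) = (\<Sum>k\<in>?P. prob (?E k))"
  proof (rule finite_measure_finite_Union[OF fin])
    have "?E k \<in> sets M" for k using J by measurable
    then show "?E ` ?P \<subseteq> sets M" by auto
    show "disjoint_family_on ?E ?P"
      unfolding disjoint_family_on_def
    proof (intro ballI impI)
      fix k k' assume k: "k \<in> ?P" "k' \<in> ?P" "k \<noteq> k'"
      \<comment> \<open>Members of \<open>PiE\<close> are fixed outside \<open>J\<close>, so
        distinct ones differ at an index in \<open>J\<close>.\<close>
      then obtain j where "j \<in> J" "k j \<noteq> k' j" using PiE_ext by blast
      then show "?E k \<inter> ?E k' = {}" by auto
    qed
  qed
  moreover have "(\<Sum>k\<in>?P. prob (?E k)) =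
     (\<integral>x. (\<Sum>k\<in>?P. \<Prod>j\<in>J. (c j * x) ^ k j / fact (k j) * exp (- (c j * x))) \<partial>mean1_gamma r)"
    unfolding pmf
    by (intro Bochner_Integration.integral_sum[symmetric] integrable.intros[OF has_bochner_integral_poisson_mixture[where J = J and c = c, OF J r c]])
       simp
  moreover have "(\<Sum>k\<in>?P. \<Prod>j\<in>J. (c j * x) ^ k j / fact (k j) * exp (- (c j * x))) =
      (\<Prod>j\<in>J. poisson_below (N j) (c j * x))" for x
    unfolding poisson_below_def using J by (subst prod_sum_PiE) auto
  ultimately show ?thesis by simp
qed

section \<open>Iterated limits\<close>

lemma has_iterated_limit_singleton:
  "(\<lambda>N. f (n(i := N))) \<longlonglongrightarrow> L \<Longrightarrow> has_iterated_limit [i] f n L"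
  by auto

text \<open>Lets nested limits be computed in stages, with \<open>h\<close> the result of the inner
  stage. The set \<open>D\<close> records the coordinates known to be positive; it grows along the
  induction, so the inner stage may assume positivity of all outer variables.\<close>

lemma has_iterated_limit_append:
  assumes "has_iterated_limit xs h n L"
    and "\<And>n. (\<And>i. i \<in> D \<union> set xs \<Longrightarrow> n i \<ge> 1) \<Longrightarrow> has_iterated_limit ys f n (h n)"
    and "\<And>i. i \<in> D \<Longrightarrow> n i \<ge> 1"
  shows "has_iterated_limit (xs @ ys) f n L"
  using assms
proof (induction xs arbitrary: n L D)
  case Nil
  then show ?case by auto
next
  case (Cons i xs)
  from Cons.prems(1) obtain g where g: "\<And>N. N \<ge> 1 \<Longrightarrow> has_iterated_limit xs h (n(i := N)) (g N)"
    and lim: "g \<longlonglongrightarrow> L" by auto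
  have "has_iterated_limit (xs @ ys) f (n(i := N)) (g N)" if "N \<ge> 1" for N
    by (rule Cons.IH[OF g[OF that], of "insert i D"]) (use Cons.prems that in auto)
  with lim show ?case by auto
qed

text \<open>Serves to replace \<open>\<pi>\<^sub>1\<close> by its mixture integral, an identity
  available only at positive arguments.\<close>

lemma has_iterated_limit_cong:
  assumes "has_iterated_limit xs h n L"
    and "\<And>n. (\<And>i. i \<in> set xs \<Longrightarrow> n i \<ge> 1) \<Longrightarrow> f n = h n"
  shows "has_iterated_limit xs f n L"
  using has_iterated_limit_append[OF assms(1), of "{}" "[]" f] assms(2) by simp

text \<open>\<open>D\<close> holds the coordinates frozen by limits further out: the induction moves
  the outermost variable from the list into \<open>D\<close>, evaluates the inner limits, and then
  lets that one factor tend to \<open>c\<close>.\<close>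

lemma has_iterated_limit_prod:
  fixes a :: "nat \<Rightarrow> real"
  assumes lim: "a \<longlonglongrightarrow> c" and "distinct xs" "finite D" "D \<inter> set xs = {}"
  shows "has_iterated_limit xs (\<lambda>n. K * (\<Prod>i\<in>D \<union> set xs. a (n i))) n (K * (\<Prod>i\<in>D. a (n i)) * c ^ length xs)"
  using assms(2-)
proof (induction xs arbitrary: n D)
  case (Cons i xs)
  let ?g = "\<lambda>N. K * (\<Prod>j\<in>insert i D. a ((n(i := N)) j)) * c ^ length xs"
  have "has_iterated_limit xs (\<lambda>n. K * (\<Prod>j\<in>D \<union> set (i # xs). a (n j))) (n(i := N)) (?g N)" for N
  proof -
    have "insert i D \<union> set xs = D \<union> set (i # xs)" by auto
    moreover have "has_iterated_limit xs (\<lambda>n. K * (\<Prod>j\<in>insert i D \<union> set xs. a (n j))) (n(i := N)) (?g N)"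
      by (rule Cons.IH) (use Cons.prems in auto)
    ultimately show ?thesis by (simp only:)
  qed
  moreover have "?g \<longlonglongrightarrow> K * (\<Prod>j\<in>D. a (n j)) * c ^ length (i # xs)"
  proof -
    have i: "i \<notin> D" using Cons.prems by auto
    have "?g = (\<lambda>N. K * (\<Prod>j\<in>D. a (n j)) * c ^ length xs * a N)"
    proof
      fix N
      have "(\<Prod>j\<in>insert i D. a ((n(i := N)) j)) = a N * (\<Prod>j\<in>D. a ((n(i := N)) j))"
        using i Cons.prems by simp
      also have "(\<Prod>j\<in>D. a ((n(i := N)) j)) = (\<Prod>j\<in>D. a (n j))"
        using i by (intro prod.cong) auto
      finally show "?g N = K * (\<Prod>j\<in>D. a (n j)) * c ^ length xs * a N" by simp
    qed
    moreover have "\<dots> \<longlonglongrightarrow> K * (\<Prod>j\<in>D. a (n j)) * c ^ length xs * c"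
      by (intro tendsto_intros lim)
    ultimately show ?thesis by (simp add: mult_ac)
  qed
  ultimately show ?case unfolding has_iterated_limit.simps by (intro exI[of _ ?g]) simp
qed simp

section \<open>Limits of the mixture integrals\<close>

lemma prod_poisson_below_bounds:
  "0 \<le> x \<Longrightarrow> 0 \<le> (\<Prod>i\<in>D. poisson_below (n i) (real (n i) * x)) \<and>
     (\<Prod>i\<in>D. poisson_below (n i) (real (n i) * x)) \<le> 1"
  by (auto intro!: prod_nonneg prod_le_1 simp: poisson_below_nonneg poisson_below_le_1)

text \<open>The first limit taken produces the factor \<open>indicator {..<1}\<close>; being idempotent, this factor absorbs
  all further ones, which is why the result depends on \<open>xs\<close> only through its emptiness.\<close>

lemma has_iterated_limit_mixture:
  assumes "n 1 \<ge> 1" "distinct xs" "finite D" "D \<inter> set xs = {}" "1 \<notin> set xs"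
  shows "has_iterated_limit xs
    (\<lambda>n. \<integral>x. (\<Prod>i\<in>D \<union> set xs. poisson_below (n i) (real (n i) * x)) \<partial>mean1_gamma (n 1)) n
    (\<integral>x. (\<Prod>i\<in>D. poisson_below (n i) (real (n i) * x)) * (if xs = [] then 1 else indicator {..<1} x) \<partial>mean1_gamma (n 1))"
  using assms
proof (induction xs arbitrary: n D)
  case (Cons i xs)
  let ?w = "\<lambda>x. if xs = [] then 1 else indicator {..<1} x :: real"
  let ?p = "\<lambda>n D x. \<Prod>j\<in>D. poisson_below (n j) (real (n j) * x)"
  let ?g = "\<lambda>N. \<integral>x. ?p (n(i := N)) (insert i D) x * ?w x \<partial>mean1_gamma (n 1)"
  interpret prob_space "mean1_gamma (n 1)" using Cons.prems by (intro prob_space_mean1_gamma) simp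
  have "has_iterated_limit xs (\<lambda>n. \<integral>x. ?p n (D \<union> set (i # xs)) x \<partial>mean1_gamma (n 1)) (n(i := N)) (?g N)" for N
  proof -
    have "insert i D \<union> set xs = D \<union> set (i # xs)" by auto
    \<comment> \<open>The index 1 is not in the list, so the mixing measure stays fixed throughout
      these limits.\<close>
    moreover have "(n(i := N)) 1 = n 1" using Cons.prems by auto
    moreover have "has_iterated_limit xs (\<lambda>n. \<integral>x. ?p n (insert i D \<union> set xs) x \<partial>mean1_gamma (n 1)) (n(i := N))
        (\<integral>x. ?p (n(i := N)) (insert i D) x * ?w x \<partial>mean1_gamma ((n(i := N)) 1))"
      by (rule Cons.IH) (use Cons.prems in auto)
    ultimately show ?thesis by (simp only:)
  qed
  moreover have "?g \<longlonglongrightarrow> (\<integral>x. ?p n D x * indicator {..<1} x \<partial>mean1_gamma (n 1))"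
  proof (rule integral_dominated_convergence[where w = "\<lambda>_. 1"])
    have i: "i \<notin> D" using Cons.prems by auto
    have split: "?p (n(i := N)) (insert i D) x = poisson_below N (real N * x) * ?p n D x" for N x
    proof -
      have "?p (n(i := N)) (insert i D) x = poisson_below N (real N * x) * ?p (n(i := N)) D x"
        using i Cons.prems by simp
      also have "?p (n(i := N)) D x = ?p n D x"
        using i by (intro prod.cong) auto
      finally show ?thesis .
    qed
    show "AE x in mean1_gamma (n 1). (\<lambda>N. ?p (n(i := N)) (insert i D) x * ?w x)
        \<longlonglongrightarrow> ?p n D x * indicator {..<1} x"
      \<comment> \<open>The pointwise limit is available at nonnegative points other than 1, and the
        Gamma law has no atom at 1.\<close>
      using AE_mean1_gamma_nonneg AE_mean1_gamma_neq[where a = 1]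
    proof eventually_elim
      case (elim x)
      have "(\<lambda>N. poisson_below N (real N * x) * ?p n D x * ?w x)
          \<longlonglongrightarrow> indicator {..<1} x * ?p n D x * ?w x"
        by (intro tendsto_intros poisson_below_scaled_tendsto elim)
      also have "indicator {..<1} x * ?p n D x * ?w x = ?p n D x * indicator {..<1} x"
        by (auto simp: indicator_def)
      finally show ?case unfolding split .
    qed
    show "AE x in mean1_gamma (n 1). norm (?p (n(i := N)) (insert i D) x * ?w x) \<le> 1" for N
      using AE_mean1_gamma_nonneg
    proof eventually_elim
      case (elim x)
      have "?p (n(i := N)) (insert i D) x * ?w x \<le> 1"
        using prod_poisson_below_bounds[OF elim, of "n(i := N)" "insert i D"]
        by (intro mult_le_one) (auto simp: indicator_def)
      moreover have "0 \<le> ?p (n(i := N)) (insert i D) x * ?w x"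
        using prod_poisson_below_bounds[OF elim, of "n(i := N)" "insert i D"]
        by (intro mult_nonneg_nonneg) auto
      ultimately show ?case by simp
    qed
    show "integrable (mean1_gamma (n 1)) (\<lambda>_. 1 :: real)" by (rule integrable_const)
  qed auto
  ultimately show ?case unfolding has_iterated_limit.simps by (intro exI[of _ ?g]) simp
qed simp

text \<open>This is the limit in the first variable. The weight is the constant 1 when that limit is
  innermost, and \<open>indicator {..<1}\<close> when other limits were taken before it.\<close>

lemma expectation_prod_poisson_below_tendsto:
  assumes [measurable]: "w \<in> borel_measurable borel" and w: "\<And>x. \<bar>w x\<bar> \<le> 1"
    and lim: "(\<lambda>N. \<integral>x. w x \<partial>mean1_gamma N) \<longlonglongrightarrow> L"
  shows "(\<lambda>N. \<integral>x. (\<Prod>i\<in>D. poisson_below (n i) (real (n i) * x)) * w x \<partial>mean1_gamma N)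
    \<longlonglongrightarrow> (\<Prod>i\<in>D. poisson_below (n i) (real (n i))) * L"
proof -
  let ?h = "\<lambda>x. \<Prod>i\<in>D. poisson_below (n i) (real (n i) * x)"
  have "isCont ?h 1"
    by (intro continuous_prod isCont_o2[OF _ isCont_poisson_below] continuous_intros)
  moreover have "\<bar>?h x\<bar> \<le> 1" if "0 \<le> x" for x
    using prod_poisson_below_bounds[OF that, of n D] by simp
  moreover have "?h \<in> borel_measurable borel" by measurable
  ultimately have "(\<lambda>N. \<integral>x. ?h x * w x \<partial>mean1_gamma N) \<longlonglongrightarrow> ?h 1 * L"
    by (intro expectation_mean1_gamma_mult_tendsto w lim) auto
  then show ?thesis by simp
qed

text \<open>Duality turns this mass into the complement of \<open>poisson_below N (real N)\<close>,
  so the Poisson central limit theorem applies.\<close>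

lemma mean1_gamma_below_mean_tendsto:
  "(\<lambda>N. \<integral>x. indicator {..<1} x \<partial>mean1_gamma N) \<longlonglongrightarrow> (1 / 2 :: real)"
proof (rule Lim_transform_eventually)
  show "(\<lambda>N. 1 - poisson_below N (real N)) \<longlonglongrightarrow> 1 / 2"
    using tendsto_diff[OF tendsto_const[of 1] poisson_below_mean_tendsto] by simp
  show "\<forall>\<^sub>F N in sequentially. 1 - poisson_below N (real N) = (\<integral>x. indicator {..<1} x \<partial>mean1_gamma N)"
    by (rule eventually_sequentiallyI[of 1]) (use measure_mean1_gamma_lessThan[of _ 1] in auto)
qed

theorem mainTheorem8:
  fixes m :: nat
    and M :: "(nat \<Rightarrow> nat) \<Rightarrow> 'w measure"
    and A :: "(nat \<Rightarrow> nat) \<Rightarrow> nat \<Rightarrow> 'w \<Rightarrow> nat"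
    and \<pi>\<^sub>1 :: "(nat \<Rightarrow> nat) \<Rightarrow> real"
    and n\<^sub>0 :: "nat \<Rightarrow> nat"
  assumes "m \<ge> 2"
    and "\<And>n. (\<forall>i\<in>{1..m}. n i \<ge> 1) \<Longrightarrow>
           neg_multinomial_distributed (M n) {2..m} (A n) (n 1)
             (\<lambda>l. real (n l) / (\<Sum>i=1..m. real (n i)))"
    and "\<And>n. (\<forall>i\<in>{1..m}. n i \<ge> 1) \<Longrightarrow>
           \<pi>\<^sub>1 n = measure (M n) {\<omega> \<in> space (M n). \<forall>l\<in>{2..m}. A n l \<omega> \<le> n l - 1}"
  shows "has_iterated_limit (rev [1..<m+1]) \<pi>\<^sub>1 n\<^sub>0 (1 / 2 ^ (m - 1)) \<and>
         (\<forall>l\<in>{2..m}. has_iterated_limit ([2..<l] @ [1] @ [l..<m+1]) \<pi>\<^sub>1 n\<^sub>0 (1 / 2 ^ (l - 1)))"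
proof -
  let ?p = "\<lambda>n D x. \<Prod>i\<in>D. poisson_below (n i) (real (n i) * x)"
  let ?H = "\<lambda>n. \<integral>x. ?p n {2..m} x \<partial>mean1_gamma (n 1)"
  have \<pi>_eq: "\<pi>\<^sub>1 n = ?H n" if n: "\<And>i. i \<in> {1..m} \<Longrightarrow> n i \<ge> 1" for n
  proof -
    \<comment> \<open>Splitting off \<open>n 1\<close> brings the denominator into the form used by
      the mixture lemma.\<close>
    have "(\<Sum>i=1..m. real (n i)) = real (n 1) + (\<Sum>i\<in>{2..m}. real (n i))"
      using assms(1) by (simp add: sum.atLeast_Suc_atMost numeral_2_eq_2)
    moreover have "neg_multinomial_distributed (M n) {2..m} (A n) (n 1)
        (\<lambda>l. real (n l) / (\<Sum>i=1..m. real (n i)))"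
      using n by (intro assms(2)) blast
    ultimately have nm: "neg_multinomial_distributed (M n) {2..m} (A n) (n 1)
        (\<lambda>l. real (n l) / (real (n 1) + (\<Sum>i\<in>{2..m}. real (n i))))"
      by (simp only:)
    \<comment> \<open>Subtraction on \<open>nat\<close> truncates at 0; the equivalence relies on
      \<open>n l \<ge> 1\<close>.\<close>
    have "A n l \<omega> \<le> n l - 1 \<longleftrightarrow> A n l \<omega> < n l" if "l \<in> {2..m}" for l \<omega>
      using n[of l] that by auto
    then have "{\<omega> \<in> space (M n). \<forall>l\<in>{2..m}. A n l \<omega> \<le> n l - 1} = {\<omega> \<in> space (M n). \<forall>l\<in>{2..m}. A n l \<omega> < n l}"
      by simp
    then have "\<pi>\<^sub>1 n = measure (M n) {\<omega> \<in> space (M n). \<forall>l\<in>{2..m}. A n l \<omega> < n l}"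
      using assms(3)[of n] n by presburger
    also have "\<dots> = ?H n"
      by (rule neg_multinomial_measure_below[OF nm]) simp
    finally show ?thesis .
  qed
  have "has_iterated_limit (rev [1..<m+1]) \<pi>\<^sub>1 n\<^sub>0 (1 / 2 ^ (m - 1))"
  proof (rule has_iterated_limit_cong)
    have rev: "rev [1..<m+1] = rev [2..<m+1] @ [1]"
      using assms(1) by (simp add: upt_conv_Cons numeral_2_eq_2)
    have "has_iterated_limit (rev [2..<m+1])
        (\<lambda>n. 1 * (\<Prod>i\<in>{} \<union> set (rev [2..<m+1]). poisson_below (n i) (real (n i)))) n\<^sub>0
        (1 * (\<Prod>i\<in>{}. poisson_below (n\<^sub>0 i) (real (n\<^sub>0 i))) * (1 / 2) ^ length (rev [2..<m+1]))"
      by (intro has_iterated_limit_prod poisson_below_mean_tendsto) auto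
    then have outer: "has_iterated_limit (rev [2..<m+1])
        (\<lambda>n. \<Prod>i\<in>{2..m}. poisson_below (n i) (real (n i))) n\<^sub>0 (1 / 2 ^ (m - 1))"
      using assms(1) by (simp add: atLeastLessThanSuc_atLeastAtMost power_one_over del: upt_Suc)
    \<comment> \<open>The update at 1 changes only the mixing measure, as the product runs over
      \<open>{2..m}\<close>; the weight is the constant 1.\<close>
    have "has_iterated_limit [1] ?H n (\<Prod>i\<in>{2..m}. poisson_below (n i) (real (n i)))" for n
    proof -
      have "?H (n(1 := N)) = (\<integral>x. ?p n {2..m} x * 1 \<partial>mean1_gamma N)" for N
        by (auto intro!: Bochner_Integration.integral_cong prod.cong)
      moreover have "(\<lambda>N. \<integral>x. ?p n {2..m} x * 1 \<partial>mean1_gamma N)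
          \<longlonglongrightarrow> (\<Prod>i\<in>{2..m}. poisson_below (n i) (real (n i))) * 1"
        by (intro expectation_prod_poisson_below_tendsto mean1_gamma_total_tendsto) auto
      ultimately show ?thesis by (intro has_iterated_limit_singleton) simp
    qed
    then show "has_iterated_limit (rev [1..<m+1]) ?H n\<^sub>0 (1 / 2 ^ (m - 1))"
      unfolding rev by (intro has_iterated_limit_append[OF outer, of "{}"]) auto
  next
    fix n :: "nat \<Rightarrow> nat"
    assume n: "\<And>i. i \<in> set (rev [1..<m+1]) \<Longrightarrow> n i \<ge> 1"
    show "\<pi>\<^sub>1 n = ?H n"
    proof (rule \<pi>_eq)
      fix i assume "i \<in> {1..m}"
      then have "i \<in> set (rev [1..<m+1])" by auto
      then show "n i \<ge> 1" by (rule n)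
    qed
  qed
  moreover have "has_iterated_limit ([2..<l] @ [1] @ [l..<m+1]) \<pi>\<^sub>1 n\<^sub>0 (1 / 2 ^ (l - 1))"
    if l: "l \<in> {2..m}" for l
  proof (rule has_iterated_limit_cong)
    let ?G = "\<lambda>n. \<integral>x. ?p n {2..<l} x * indicator {..<1} x \<partial>mean1_gamma (n 1)"
    \<comment> \<open>The leading \<open>1 / 2\<close> is the limiting Gamma mass below 1, left by
      the limits further in; the \<open>l - 2\<close> outer variables supply the other
      factors.\<close>
    have "has_iterated_limit [2..<l]
        (\<lambda>n. 1 / 2 * (\<Prod>i\<in>{} \<union> set [2..<l]. poisson_below (n i) (real (n i)))) n\<^sub>0
        (1 / 2 * (\<Prod>i\<in>{}. poisson_below (n\<^sub>0 i) (real (n\<^sub>0 i))) * (1 / 2) ^ length [2..<l])"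
      by (intro has_iterated_limit_prod poisson_below_mean_tendsto) auto
    moreover have "(1 / 2) * (1 / 2) ^ (l - 2) = (1 / 2 ^ (l - 1) :: real)"
      using l by (simp add: power_one_over flip: power_Suc Suc_diff_le)
    ultimately have outer: "has_iterated_limit [2..<l]
        (\<lambda>n. 1 / 2 * (\<Prod>i\<in>{2..<l}. poisson_below (n i) (real (n i)))) n\<^sub>0 (1 / 2 ^ (l - 1))"
      by simp
    have "has_iterated_limit [1] ?G n (1 / 2 * (\<Prod>i\<in>{2..<l}. poisson_below (n i) (real (n i))))" for n
    proof -
      have "?G (n(1 := N)) = (\<integral>x. ?p n {2..<l} x * indicator {..<1} x \<partial>mean1_gamma N)" for N
        by (auto intro!: Bochner_Integration.integral_cong prod.cong)
      moreover have "(\<lambda>N. \<integral>x. ?p n {2..<l} x * indicator {..<1} x \<partial>mean1_gamma N)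
          \<longlonglongrightarrow> (\<Prod>i\<in>{2..<l}. poisson_below (n i) (real (n i))) * (1 / 2)"
        by (intro expectation_prod_poisson_below_tendsto mean1_gamma_below_mean_tendsto)
           (auto simp: indicator_def)
      ultimately show ?thesis by (intro has_iterated_limit_singleton) (simp add: mult.commute)
    qed
    then have middle: "has_iterated_limit ([2..<l] @ [1]) ?G n\<^sub>0 (1 / 2 ^ (l - 1))"
      by (intro has_iterated_limit_append[OF outer, of "{}"]) auto
    \<comment> \<open>The guard on \<open>n 1\<close> makes the mixing measure a probability; it is
      met because the limit in \<open>n 1\<close> lies further out.\<close>
    have "has_iterated_limit [l..<m+1] ?H n (?G n)" if "n 1 \<ge> 1" for n
    proof -
      have "has_iterated_limit [l..<m+1] (\<lambda>n. \<integral>x. ?p n ({2..<l} \<union> set [l..<m+1]) x \<partial>mean1_gamma (n 1)) n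
         (\<integral>x. ?p n {2..<l} x * (if [l..<m+1] = [] then 1 else indicator {..<1} x) \<partial>mean1_gamma (n 1))"
        using l that by (intro has_iterated_limit_mixture) auto
      \<comment> \<open>Since \<open>l \<le> m\<close> the list is nonempty, so the factor
        \<open>indicator {..<1}\<close> is present.\<close>
      moreover have "{2..<l} \<union> set [l..<m+1] = {2..m}" "[l..<m+1] \<noteq> []" using l by auto
      ultimately show ?thesis by (simp only: if_False)
    qed
    then have "has_iterated_limit (([2..<l] @ [1]) @ [l..<m+1]) ?H n\<^sub>0 (1 / 2 ^ (l - 1))"
      by (intro has_iterated_limit_append[OF middle, of "{}"]) auto
    then show "has_iterated_limit ([2..<l] @ [1] @ [l..<m+1]) ?H n\<^sub>0 (1 / 2 ^ (l - 1))"
      by (simp only: append_assoc)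
  next
    fix n :: "nat \<Rightarrow> nat"
    assume n: "\<And>i. i \<in> set ([2..<l] @ [1] @ [l..<m+1]) \<Longrightarrow> n i \<ge> 1"
    show "\<pi>\<^sub>1 n = ?H n"
    proof (rule \<pi>_eq)
      fix i assume "i \<in> {1..m}"
      then have "i \<in> set ([2..<l] @ [1] @ [l..<m+1])" by auto
      then show "n i \<ge> 1" by (rule n)
    qed
  qed
  ultimately show ?thesis by blast
qed

end
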